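(* For all $m,n\ge 1$ and $d\in\mathbb{N}$, the linear span $\langle\mathrm{uMPS}(m,n,d)\rangle\subseteq(\mathbb{C}^n)^{\otimes d}$ of the variety of uniform matrix product states has dimension equal to $\dim R^{\mathrm{cyc}}_{m,n;d}$. In other words, $$\sum_{d\in\mathbb{N}}\dim\langle\mathrm{uMPS}(m,n,d)\rangle\,t^d=H(R^{\mathrm{cyc}}_{m,n};t,\ldots,t).$$
   Context: We work over $\mathbb{C}$, and $\mathbb{N}$ includes $0$. Uniform matrix product states: let $e_1,\ldots,e_n$ be the standard basis of $\mathbb{C}^n$. The variety $\mathrm{uMPS}(m,n,d)\subseteq(\mathbb{C}^n)^{\otimes d}$ is the closure of the image of the map $$(\mathbb{C}^{m\times m})^{n}\to(\mathbb{C}^n)^{\otimes d},\qquad (A_1,\ldots,A_n)\mapsto\sum_{1\le i_1,\ldots,i_d\le n}\operatorname{Tr}(A_{i_1}\cdots A_{i_d})\,e_{i_1}\otimes\cdots\otimes e_{i_d}.$$ (For $d=0$ the tensor space is $\mathbb{C}$ and the empty product is the identity matrix.) The notation $\langle\cdot\rangle$ denotes linear span. The space $R^{\mathrm{cyc}}_{m,n}$: let $\mathbb{C}[X_1,\ldots,X_n]$ denote the commutative polynomial ring $\mathbb{C}[x^k_{ij}\mid 1\le i,j\le m,\ 1\le k\le n]$, where $X_k=(x^k_{ij})_{ij}$ is the generic $m\times m$ matrix. It is $\mathbb{N}^n$-graded by letting $x^k_{ij}$ have degree the $k$-th standard basis vector. Let $R_{m,n}=\mathbb{C}[X_1,\ldots,X_n]^{GL_m}$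 be the (graded) subring of polynomials invariant under simultaneous conjugation $(X_1,\ldots,X_n)\mapsto(gX_1g^{-1},\ldots,gX_ng^{-1})$, $g\in GL_m(\mathbb{C})$. Then $R^{\mathrm{cyc}}_{m,n}\subseteq R_{m,n}$ is the graded linear subspace spanned by the elements of the form $\operatorname{Tr}(g(X_1,\ldots,X_n))$, where $g(x_1,\ldots,x_n)$ ranges over the noncommutative polynomial ring $\mathbb{C}\langle x_1,\ldots,x_n\rangle$; $R^{\mathrm{cyc}}_{m,n;d}$ denotes its part of total degree $d$. Hilbert series: for an $\mathbb{N}^n$-graded vector space $R$, $H(R;t_1,\ldots,t_n)=\sum_{(d_1,\ldots,d_n)\in\mathbb{N}^n}\dim R_{(d_1,\ldots,d_n)}\,t_1^{d_1}\cdots t_n^{d_n}$. *)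

theory Defs
  imports "HOL-Analysis.Analysis" "HOL-Library.Poly_Mapping"
    "HOL-Computational_Algebra.Formal_Power_Series"
begin

section \<open>Finitely supported functions as complex vector spaces\<close>

abbreviation lookup :: "('a \<Rightarrow>\<^sub>0 'b) \<Rightarrow> 'a \<Rightarrow> 'b::zero" where
  "lookup \<equiv> Poly_Mapping.lookup"

abbreviation keys :: "('a \<Rightarrow>\<^sub>0 'b::zero) \<Rightarrow> 'a set" where
  "keys \<equiv> Poly_Mapping.keys"

definition cscale :: "complex \<Rightarrow> ('a \<Rightarrow>\<^sub>0 complex) \<Rightarrow> ('a \<Rightarrow>\<^sub>0 complex)" where
  "cscale c f = Poly_Mapping.map ((*) c) f"

lemma lookup_cscale [simp]: "lookup (cscale c f) x = c * lookup f x"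
  by (simp add: cscale_def map.rep_eq when_def)

text \<open>\<open>cvs.span\<close> and \<open>cvs.dim\<close> are linear span and dimension over the complex numbers; as always
  in the library, \<open>cvs.dim\<close> is \<open>0\<close> on subspaces of infinite dimension.\<close>

global_interpretation cvs: vector_space cscale
  by unfold_locales (auto intro!: poly_mapping_eqI simp: lookup_add algebra_simps)


section \<open>Polynomials in commuting variables\<close>

text \<open>Polynomials over \<open>\<complex>\<close> with variables in \<open>'v\<close>: a monomial is its finitely supported exponent
  vector, a polynomial is its finitely supported coefficient function, and multiplication is the
  convolution product of \<open>HOL-Library.Poly_Mapping\<close>.\<close>

type_synonym 'v cpoly = "('v \<Rightarrow>\<^sub>0 nat) \<Rightarrow>\<^sub>0 complex"

definition Const :: "complex \<Rightarrow> 'v cpoly" where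
  "Const c = Poly_Mapping.single 0 c"

definition Var :: "'v \<Rightarrow> 'v cpoly" where
  "Var v = Poly_Mapping.single (Poly_Mapping.single v 1) 1"

text \<open>Image of a polynomial under the ring homomorphism which is \<open>h\<close> on coefficients and sends
  the variable \<open>v\<close> to \<open>a v\<close>.\<close>

definition poly_eval :: "(complex \<Rightarrow> 'b) \<Rightarrow> ('v \<Rightarrow> 'b) \<Rightarrow> 'v cpoly \<Rightarrow> 'b::comm_ring_1" where
  "poly_eval h a p =
     (\<Sum>u\<in>keys p. h (lookup p u) * (\<Prod>v\<in>keys u. a v ^ lookup u v))"

lemma poly_eval_superset:
  assumes "finite A" "keys p \<subseteq> A" "h 0 = 0"
  shows "poly_eval h a p = (\<Sum>u\<in>A. h (lookup p u) * (\<Prod>v\<in>keys u. a v ^ lookup u v))"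
  unfolding poly_eval_def
  by (rule sum.mono_neutral_left) (use assms in \<open>auto simp: in_keys_iff\<close>)

lemma poly_eval_single:
  assumes "h 0 = 0"
  shows "poly_eval h a (Poly_Mapping.single u c) = h c * (\<Prod>v\<in>keys u. a v ^ lookup u v)"
  by (subst poly_eval_superset[of "{u}"]) (use assms in auto)

lemma poly_eval_add:
  assumes "h 0 = 0" "\<And>x y. h (x + y) = h x + h y"
  shows "poly_eval h a (p + q) = poly_eval h a p + poly_eval h a q"
proof -
  let ?A = "keys p \<union> keys q"
  show ?thesis
    using keys_add[of p q] assms
    by (simp add: poly_eval_superset[of ?A] lookup_add distrib_right sum.distrib)
qed

lemma poly_eval_sum:
  assumes "h 0 = 0" "\<And>x y. h (x + y) = h x + h y"
  shows "poly_eval h a (\<Sum>i\<in>I. f i) = (\<Sum>i\<in>I. poly_eval h a (f i))"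
proof (induction I rule: infinite_finite_induct)
  case (insert i I)
  then show ?case by (simp add: poly_eval_add[OF assms])
qed (simp_all add: poly_eval_def)

lemma monomial_eval_superset:
  fixes a :: "'v \<Rightarrow> 'b::comm_ring_1"
  assumes "finite A" "keys u \<subseteq> A"
  shows "(\<Prod>v\<in>keys u. a v ^ lookup u v) = (\<Prod>v\<in>A. a v ^ lookup u v)"
  by (rule prod.mono_neutral_left) (use assms in \<open>auto simp: in_keys_iff\<close>)

lemma monomial_eval_add:
  fixes a :: "'v \<Rightarrow> 'b::comm_ring_1"
  shows "(\<Prod>v\<in>keys (u + w). a v ^ lookup (u + w) v) =
    (\<Prod>v\<in>keys u. a v ^ lookup u v) * (\<Prod>v\<in>keys w. a v ^ lookup w v)"
proof -
  let ?A = "keys u \<union> keys w"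
  show ?thesis
    by (subst monomial_eval_superset[of ?A u], simp, simp, subst monomial_eval_superset[of ?A w],
        simp, simp, subst monomial_eval_superset[of ?A, OF _ keys_add])
      (simp_all add: lookup_add power_add prod.distrib)
qed

lemma poly_mapping_as_sum: "p = (\<Sum>u\<in>keys p. Poly_Mapping.single u (lookup p u))"
  by (rule poly_mapping_eqI)
    (auto simp: lookup_sum lookup_single when_def in_keys_iff)

lemma poly_eval_mult:
  assumes h: "h 0 = 0" "\<And>x y. h (x + y) = h x + h y" "\<And>x y. h (x * y) = h x * h y"
  shows "poly_eval h a (p * q) = poly_eval h a p * poly_eval h a q"
proof -
  have "p * q = (\<Sum>u\<in>keys p. \<Sum>w\<in>keys q.
      Poly_Mapping.single (u + w) (lookup p u * lookup q w))"
    by (subst (1) poly_mapping_as_sum[of p], subst (1) poly_mapping_as_sum[of q])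
      (simp add: sum_product mult_single)
  then have "poly_eval h a (p * q) = (\<Sum>u\<in>keys p. \<Sum>w\<in>keys q.
      (h (lookup p u) * (\<Prod>v\<in>keys u. a v ^ lookup u v)) *
      (h (lookup q w) * (\<Prod>v\<in>keys w. a v ^ lookup w v)))"
    by (simp add: poly_eval_sum[OF h(1,2)] poly_eval_single[where h = h, OF h(1)] h(3) monomial_eval_add mult_ac)
  then show ?thesis
    by (simp add: poly_eval_def sum_product)
qed

lemma poly_eval_Const [simp]: "h 0 = 0 \<Longrightarrow> poly_eval h a (Const c) = h c"
  by (simp add: Const_def poly_eval_single)

lemma poly_eval_Var [simp]: "h 0 = 0 \<Longrightarrow> h 1 = 1 \<Longrightarrow> poly_eval h a (Var v) = a v"
  by (simp add: Var_def poly_eval_single)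

lemma Const_simps [simp]:
  "Const 0 = 0" "Const 1 = 1" "Const (c + d) = Const c + Const d" "Const (c * d) = Const c * Const d"
  by (simp_all add: Const_def single_add mult_single)

lemma Const_sum: "Const (\<Sum>i\<in>I. f i) = (\<Sum>i\<in>I. Const (f i))"
  by (induction I rule: infinite_finite_induct) auto

lemma cscale_conv_mult: "cscale c p = Const c * p"
  by (simp add: cscale_def Const_def mult_map_scale_conv_mult)

text \<open>Zariski closure of a set \<open>S\<close> of points of the affine space \<open>\<complex>\<^sup>I\<close>, whose points are the
  functions supported in the finite set \<open>I\<close>.\<close>

definition zariski_closure :: "'v set \<Rightarrow> ('v \<Rightarrow>\<^sub>0 complex) set \<Rightarrow> ('v \<Rightarrow>\<^sub>0 complex) set" where
  "zariski_closure I S =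
     {T. keys T \<subseteq> I \<and>
         (\<forall>p :: 'v cpoly. (\<forall>u\<in>keys p. keys u \<subseteq> I) \<longrightarrow>
            (\<forall>s\<in>S. poly_eval id (lookup s) p = 0) \<longrightarrow> poly_eval id (lookup T) p = 0)}"


section \<open>Uniform matrix product states\<close>

text \<open>The sizes \<open>m, n \<ge> 1\<close> are the cardinalities of the finite types \<open>'m\<close> and \<open>'n\<close>: a matrix of type
  \<open>'a ^ 'm ^ 'm\<close> is an \<open>m \<times> m\<close> matrix, and \<open>'n\<close> indexes the standard basis of \<open>\<complex>\<^sup>n\<close>. A tensor in
  \<open>(\<complex>\<^sup>n)\<^sup>\<otimes>\<^sup>d\<close> is a function supported on the words of length \<open>d\<close>, and the basis tensor of a word
  \<open>w\<close> is \<open>Poly_Mapping.single w 1\<close>.\<close>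

definition words :: "nat \<Rightarrow> 'n list set" where
  "words d = {w. length w = d}"

definition word_prod :: "('n \<Rightarrow> 'a ^ 'm ^ 'm) \<Rightarrow> 'n list \<Rightarrow> 'a::semiring_1 ^ 'm ^ 'm" where
  "word_prod A w = foldr (\<lambda>k M. A k ** M) w (mat 1)"

definition mps_map :: "nat \<Rightarrow> ('n::finite \<Rightarrow> complex ^ 'm ^ 'm) \<Rightarrow> ('n list \<Rightarrow>\<^sub>0 complex)" where
  "mps_map d A = (\<Sum>w\<in>words d. cscale (trace (word_prod A w)) (Poly_Mapping.single w 1))"

definition uMPS :: "'m::finite itself \<Rightarrow> 'n::finite itself \<Rightarrow> nat \<Rightarrow> ('n list \<Rightarrow>\<^sub>0 complex) set" where
  "uMPS _ _ d = zariski_closure (words d) (range (mps_map d :: ('n \<Rightarrow> complex ^ 'm ^ 'm) \<Rightarrow> _))"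


section \<open>Generic matrices, invariants and traces\<close>

text \<open>The entry \<open>(i, j)\<close> of the \<open>k\<close>-th generic matrix is the variable \<open>(k, i, j)\<close>.\<close>

type_synonym ('m, 'n) mat_poly = "('n \<times> 'm \<times> 'm) cpoly"

definition generic_mat :: "'n \<Rightarrow> ('m::finite, 'n) mat_poly ^ 'm ^ 'm" where
  "generic_mat k = (\<chi> i j. Var (k, i, j))"

definition const_mat :: "complex ^ 'm ^ 'm \<Rightarrow> ('m::finite, 'n) mat_poly ^ 'm ^ 'm" where
  "const_mat g = (\<chi> i j. Const (g $ i $ j))"

definition conj_subst :: "complex ^ 'm ^ 'm \<Rightarrow> ('m::finite, 'n) mat_poly \<Rightarrow> ('m, 'n) mat_poly" where
  "conj_subst g =
     poly_eval Const (\<lambda>(k, i, j). (const_mat g ** generic_mat k ** const_mat (matrix_inv g)) $ i $ j)"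

definition R_inv :: "'m::finite itself \<Rightarrow> 'n::finite itself \<Rightarrow> ('m, 'n) mat_poly set" where
  "R_inv _ _ = {p. \<forall>g :: complex ^ 'm ^ 'm. invertible g \<longrightarrow> conj_subst g p = p}"

text \<open>A noncommutative polynomial is the finitely supported function sending a word in the variables
  to its coefficient.\<close>

type_synonym 'n nc_poly = "'n list \<Rightarrow>\<^sub>0 complex"

definition nc_eval :: "'n nc_poly \<Rightarrow> ('n \<Rightarrow> ('m, 'n) mat_poly ^ 'm ^ 'm) \<Rightarrow>
    ('m::finite, 'n) mat_poly ^ 'm ^ 'm" where
  "nc_eval f X = (\<Sum>w\<in>keys f. mat (Const (lookup f w)) ** word_prod X w)"

definition R_cyc :: "'m::finite itself \<Rightarrow> 'n::finite itself \<Rightarrow> ('m, 'n) mat_poly set" where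
  "R_cyc _ _ = cvs.span (range (\<lambda>f. trace (nc_eval f generic_mat)))"

lemma R_cyc_subset_R_inv: "R_cyc TYPE('m::finite) TYPE('n::finite) \<subseteq> R_inv TYPE('m) TYPE('n)"
proof -
  have inv: "p \<in> R_inv TYPE('m) TYPE('n)"
    if pr: "p \<in> range (\<lambda>f. trace (nc_eval f generic_mat))" for p
  proof -
    obtain f :: "'n nc_poly" where p: "p = trace (nc_eval f generic_mat)"
      using pr by blast
    have "conj_subst g p = p" if g: "invertible g" for g :: "complex ^ 'm ^ 'm"
    proof -
      let ?E = "conj_subst g :: ('m, 'n) mat_poly \<Rightarrow> _"
      let ?G = "const_mat g :: ('m, 'n) mat_poly ^ 'm ^ 'm"
      let ?H = "const_mat (matrix_inv g) :: ('m, 'n) mat_poly ^ 'm ^ 'm"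
      let ?M = "\<lambda>A :: ('m, 'n) mat_poly ^ 'm ^ 'm. (\<chi> i j. ?E (A $ i $ j))"
      have E0: "?E 0 = 0" by (simp add: conj_subst_def poly_eval_def)
      have EC: "?E (Const c) = Const c" for c by (simp add: conj_subst_def)
      have E1: "?E 1 = 1" using EC[of 1] by simp
      have Es: "?E (\<Sum>i\<in>I. q i) = (\<Sum>i\<in>I. ?E (q i))" for q and I :: "'z set"
        unfolding conj_subst_def by (rule poly_eval_sum) auto
      have Em: "?E (a * b) = ?E a * ?E b" for a b
        unfolding conj_subst_def by (rule poly_eval_mult) auto
      have Mm: "?M (A ** B) = ?M A ** ?M B" for A B
        by (simp add: vec_eq_iff matrix_matrix_mult_def Es Em)
      have cm: "(const_mat (a ** b) :: ('m, 'n) mat_poly ^ 'm ^ 'm) = const_mat a ** const_mat b" for a b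
        by (simp add: vec_eq_iff const_mat_def matrix_matrix_mult_def Const_sum)
      have c1: "(const_mat (mat 1) :: ('m, 'n) mat_poly ^ 'm ^ 'm) = mat 1"
        by (simp add: vec_eq_iff const_mat_def mat_def)
      have gh: "g ** matrix_inv g = mat 1" "matrix_inv g ** g = mat 1"
        using g someI_ex[of "\<lambda>g'. g ** g' = mat 1 \<and> g' ** g = mat 1"]
        by (auto simp: invertible_def matrix_inv_def)
      have GH: "?G ** ?H = mat 1" "?H ** ?G = mat 1"
        by (simp_all add: gh c1 flip: cm)
      have Mmat: "?M (mat (Const c)) = mat (Const c)" for c
        by (simp add: vec_eq_iff mat_def EC E0)
      have Mgen: "?M (generic_mat k) = ?G ** generic_mat k ** ?H" for k
        by (simp add: vec_eq_iff generic_mat_def[of k] conj_subst_def)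
      have Mw: "?M (word_prod generic_mat w) = ?G ** word_prod generic_mat w ** ?H" for w
      proof (induction w)
        case Nil
        then show ?case using Mmat[of 1] by (simp add: word_prod_def GH)
      next
        case (Cons k w)
        have "?M (word_prod generic_mat (k # w)) =
            ?G ** generic_mat k ** ?H ** (?G ** word_prod generic_mat w ** ?H)"
          using Cons by (simp add: word_prod_def Mm Mgen)
        also have "\<dots> = ?G ** generic_mat k ** (?H ** ?G) ** word_prod generic_mat w ** ?H"
          by (simp only: matrix_mul_assoc)
        finally show ?case by (simp add: GH word_prod_def matrix_mul_assoc)
      qed
      have tr: "?E (trace A) = trace (?M A)" for A by (simp add: trace_def Es)
      have tr_conj: "trace (?G ** A ** ?H) = trace A" for A
        using trace_mul_sym[of "?G ** A" ?H] by (simp add: matrix_mul_assoc GH)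
      have tr_scal: "trace (mat c ** A) = c * trace A" for c and A :: "('m, 'n) mat_poly ^ 'm ^ 'm"
        by (simp add: trace_def matrix_matrix_mult_def mat_def if_distrib[of "\<lambda>x. x * _"]
            sum_distrib_left cong: if_cong)
      have tr_sum: "trace (\<Sum>w\<in>W. B w) = (\<Sum>w\<in>W. trace (B w))"
        for B :: "'n list \<Rightarrow> ('m, 'n) mat_poly ^ 'm ^ 'm" and W
        by (simp add: trace_def sum.swap[of _ W])
      have p': "p = (\<Sum>w\<in>keys f. Const (lookup f w) * trace (word_prod generic_mat w))"
        unfolding p nc_eval_def by (simp add: tr_sum tr_scal)
      show ?thesis
        by (simp add: p' Es Em EC tr Mw tr_conj)
    qed
    then show ?thesis by (simp add: R_inv_def)
  qed
  have "cvs.subspace (R_inv TYPE('m) TYPE('n))"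
    by (rule cvs.subspaceI)
      (auto simp: R_inv_def conj_subst_def cscale_conv_mult poly_eval_add poly_eval_mult,
        simp add: poly_eval_def)
  then show ?thesis
    unfolding R_cyc_def using inv by (intro cvs.span_minimal) auto
qed


section \<open>Gradings and Hilbert series\<close>

definition multidegree :: "('n \<times> 'm \<times> 'm \<Rightarrow>\<^sub>0 nat) \<Rightarrow> 'n \<Rightarrow> nat" where
  "multidegree u k = (\<Sum>v\<in>{v\<in>keys u. fst v = k}. lookup u v)"

definition multidegree_part :: "('m, 'n) mat_poly set \<Rightarrow> ('n \<Rightarrow> nat) \<Rightarrow> ('m, 'n) mat_poly set" where
  "multidegree_part V \<delta> = {p\<in>V. \<forall>u\<in>keys p. multidegree u = \<delta>}"

definition degree_part :: "('m, 'n) mat_poly set \<Rightarrow> nat \<Rightarrow> ('m, 'n) mat_poly set" where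
  "degree_part V d = {p\<in>V. \<forall>u\<in>keys p. (\<Sum>v\<in>keys u. lookup u v) = d}"

text \<open>A power series in the variables \<open>t\<^sub>k\<close>, \<open>k :: 'n\<close>, is represented by its coefficient function
  on \<open>'n \<Rightarrow> nat\<close>; \<open>diagonal_fps\<close> substitutes \<open>t\<close> for all the \<open>t\<^sub>k\<close>.\<close>

definition hilbert_series :: "('m, 'n::finite) mat_poly set \<Rightarrow> ('n \<Rightarrow> nat) \<Rightarrow> nat" where
  "hilbert_series V \<delta> = cvs.dim (multidegree_part V \<delta>)"

definition diagonal_fps :: "(('n::finite \<Rightarrow> nat) \<Rightarrow> nat) \<Rightarrow> nat fps" where
  "diagonal_fps H = Abs_fps (\<lambda>d. \<Sum>\<delta> | (\<Sum>k\<in>UNIV. \<delta> k) = d. H \<delta>)"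

end

theory Submission
  imports Defs
begin

text \<open>A linear form vanishing on a set is in particular a polynomial vanishing on it, so a set and its
  Zariski closure have the same span. The coefficients of the tensor of \<open>A\<close> are the values at \<open>A\<close> of the
  polynomials \<open>Tr (X\<^bsub>w\<^esub>)\<close>, where \<open>w\<close> runs over the words of length \<open>d\<close>. The span of these tensors is the
  row space, and the span of the polynomials, which are determined by their values, the column space
  of one matrix with rows \<open>A\<close> and columns \<open>w\<close>. As \<open>Tr (X\<^bsub>w\<^esub>)\<close> is multihomogeneous with
  multidegree the letter count of \<open>w\<close>, the column space is the degree \<open>d\<close> part of the trace space and
  splits into multidegree parts.\<close>

section \<open>Linear algebra on finitely supported functions\<close>

text \<open>The predicate is left arbitrary because this projection has two uses: restricting a
  tensor to a set of words, and taking a homogeneous part of a polynomial.\<close>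

definition component :: "('a \<Rightarrow> bool) \<Rightarrow> ('a \<Rightarrow>\<^sub>0 complex) \<Rightarrow> ('a \<Rightarrow>\<^sub>0 complex)" where
  "component P f = (\<Sum>u | u \<in> keys f \<and> P u. Poly_Mapping.single u (lookup f u))"

lemma lookup_component: "lookup (component P f) u = (if P u then lookup f u else 0)"
  by (auto simp: component_def lookup_sum lookup_single when_def in_keys_iff)

lemma module_hom_component: "module_hom cscale cscale (component P)"
  by (intro module_hom.intro module_hom_axioms.intro cvs.module_axioms)
    (auto intro!: poly_mapping_eqI simp: lookup_component lookup_add)

lemmas component_0 = module_hom.zero[OF module_hom_component]
  and component_sum = module_hom.sum[OF module_hom_component]
  and component_cscale = module_hom.scale[OF module_hom_component]
  and span_image_component = module_hom.span_image[OF module_hom_component]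
  and inj_on_component_iff = module_hom.inj_on_iff_eq_0[OF module_hom_component]
  and independent_image_component = module_hom.independent_injective_image[OF module_hom_component]

lemma component_eq_self: "(\<And>u. u \<in> keys f \<Longrightarrow> P u) \<Longrightarrow> component P f = f"
  by (rule poly_mapping_eqI) (auto simp: lookup_component in_keys_iff)

lemma component_eq_0: "(\<And>u. u \<in> keys f \<Longrightarrow> \<not> P u) \<Longrightarrow> component P f = 0"
  by (rule poly_mapping_eqI) (auto simp: lookup_component in_keys_iff)

lemma lookup_eq_0_of_keys_subset: "keys f \<subseteq> I \<Longrightarrow> x \<notin> I \<Longrightarrow> lookup f x = 0"
  by (auto simp: in_keys_iff)

lemma poly_mapping_as_cscale_sum:
  assumes "finite I" "keys f \<subseteq> I"
  shows "f = (\<Sum>a\<in>I. cscale (lookup f a) (Poly_Mapping.single a 1))"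
  by (rule poly_mapping_eqI)
    (use assms in \<open>auto simp: lookup_sum lookup_single when_def lookup_eq_0_of_keys_subset if_distrib
      cong: if_cong\<close>)

section \<open>Linear functionals and rank\<close>

text \<open>Extend a basis of the span by \<open>v\<close>, then to a basis of the whole space; the
  coordinate at \<open>v\<close> is the functional. It is given by its values on the unit vectors,
  so it acts as a finite sum over any finite \<open>I\<close> containing the support.\<close>

lemma separating_functional:
  fixes v :: "'a \<Rightarrow>\<^sub>0 complex"
  assumes "v \<notin> cvs.span S"
  obtains \<phi> where
    "\<And>I s. finite I \<Longrightarrow> keys s \<subseteq> I \<Longrightarrow> s \<in> cvs.span S \<Longrightarrow> (\<Sum>a\<in>I. \<phi> a * lookup s a) = 0"
    "\<And>I. finite I \<Longrightarrow> keys v \<subseteq> I \<Longrightarrow> (\<Sum>a\<in>I. \<phi> a * lookup v a) = 1"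
proof -
  obtain B where B: "B \<subseteq> S" "cvs.independent B" "S \<subseteq> cvs.span B"
    by (rule cvs.maximal_independent_subset)
  have span_B: "cvs.span B = cvs.span S"
    using B by (metis cvs.span_eq cvs.span_superset order_trans)
  have "cvs.independent (insert v B)"
    using assms B(2) span_B by (simp add: cvs.independent_insertI)
  then obtain C where C: "insert v B \<subseteq> C" "cvs.independent C" "UNIV \<subseteq> cvs.span C"
    by (rule cvs.maximal_independent_subset_extend[OF subset_UNIV])
  have inC: "x \<in> cvs.span C" for x using C(3) by auto
  define \<phi> where "\<phi> a = cvs.representation C (Poly_Mapping.single a 1) v" for a
  have \<phi>: "(\<Sum>a\<in>I. \<phi> a * lookup x a) = cvs.representation C x v"
    if "finite I" "keys x \<subseteq> I" for I x
  proof -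
    have "cvs.representation C x v = cvs.representation C
        (\<Sum>a\<in>I. cscale (lookup x a) (Poly_Mapping.single a 1)) v"
      using poly_mapping_as_cscale_sum[OF that] by simp
    also have "\<dots> = (\<Sum>a\<in>I. \<phi> a * lookup x a)"
      by (simp add: cvs.representation_sum[OF C(2) inC] cvs.representation_scale[OF C(2) inC]
          \<phi>_def mult.commute)
    finally show ?thesis by simp
  qed
  have "cvs.representation C s v = 0" if "s \<in> cvs.span S" for s
  proof -
    \<comment> \<open>Elements of the span are already combinations of \<open>B\<close>, and
      \<open>v\<close> is not in \<open>B\<close>, so their coordinate at \<open>v\<close> is
      0.\<close>
    have "cvs.representation C s = cvs.representation B s"
      using C that span_B by (intro cvs.representation_extend) auto
    moreover have "v \<notin> B"
      using assms B(1) cvs.span_base by blast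
    ultimately show ?thesis
      using cvs.representation_ne_zero[of B s v] by auto
  qed
  moreover have "cvs.representation C v v = 1"
    using C by (simp add: cvs.representation_basis)
  ultimately show ?thesis
    by (intro that[of \<phi>]) (simp_all only: \<phi>)
qed

text \<open>Row rank equals column rank, where the matrix enters only through the linear relations between
  its columns: these are the relations between the vectors \<open>T w\<close>.\<close>

lemma dim_span_eq_of_same_relations:
  fixes S :: "('a \<Rightarrow>\<^sub>0 complex) set" and T :: "'a \<Rightarrow> ('b \<Rightarrow>\<^sub>0 complex)"
  assumes I: "finite I" and S: "\<And>s. s \<in> S \<Longrightarrow> keys s \<subseteq> I"
    and rel: "\<And>c. (\<Sum>w\<in>I. cscale (c w) (T w)) = 0 \<longleftrightarrow> (\<forall>s\<in>S. (\<Sum>w\<in>I. c w * lookup s w) = 0)"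
  shows "cvs.dim (cvs.span S) = cvs.dim (cvs.span (T ` I))"
proof -
  obtain B0 where B0: "B0 \<subseteq> T ` I" "cvs.independent B0" "T ` I \<subseteq> cvs.span B0"
    by (rule cvs.maximal_independent_subset)
  \<comment> \<open>\<open>T\<close> may repeat columns, so one index is chosen for each basis
    column.\<close>
  obtain B where B: "B \<subseteq> I" "inj_on T B" "B0 = T ` B"
    using B0(1) by (meson subset_image_inj)
  have finB: "finite B" using B(1) I finite_subset by blast
  have dimT: "cvs.dim (cvs.span (T ` I)) = card B"
  proof -
    have "cvs.dim (T ` I) = card B0"
      using B0 by (intro cvs.dim_unique) auto
    then show ?thesis using B by (simp add: card_image)
  qed
  \<comment> \<open>The aim is that restriction to the coordinates in \<open>B\<close> maps
    \<open>cvs.span S\<close> isomorphically onto the span of the unit vectors \<open>e b\<close>,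
    which has dimension \<open>card B\<close>.\<close>
  define e :: "'a \<Rightarrow> ('a \<Rightarrow>\<^sub>0 complex)" where "e = (\<lambda>b. Poly_Mapping.single b 1)"
  define \<pi> where "\<pi> = component (\<lambda>w. w \<in> B)"
  have rel_span: "(\<Sum>w\<in>I. c w * lookup s w) = 0"
    if "s \<in> cvs.span S" "(\<Sum>w\<in>I. cscale (c w) (T w)) = 0" for c s
    using that(1)
  proof (induction rule: cvs.span_induct_alt)
    case (step a x y)
    then show ?case
      using rel[of c] that(2)
      by (simp add: lookup_add distrib_left sum.distrib mult.left_commute[of _ a]
          flip: sum_distrib_left)
  qed simp
  have keys_span: "keys s \<subseteq> I" if "s \<in> cvs.span S" for s
    using that
  proof (induction rule: cvs.span_induct_alt)
    case (step a x y)
    then have "lookup (cscale a x + y) w = 0" if "w \<notin> I" for w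
      using that S[of x] by (simp add: lookup_add lookup_eq_0_of_keys_subset)
    then show ?case by (auto simp: in_keys_iff)
  qed simp
  \<comment> \<open>Each column is a combination of the columns in \<open>B\<close>. The rows
    satisfy the same relation, so the entries of \<open>s\<close> in \<open>B\<close> determine all
    its entries.\<close>
  have inj: "inj_on \<pi> (cvs.span S)"
  proof -
    have "s = 0" if s: "s \<in> cvs.span S" and "\<pi> s = 0" for s
    proof (rule poly_mapping_eqI)
      fix w
      have sB: "lookup s b = 0" if "b \<in> B" for b
        using \<open>\<pi> s = 0\<close> that lookup_component[of "\<lambda>w. w \<in> B" s b] by (simp add: \<pi>_def)
      show "lookup s w = lookup 0 w"
      proof (cases "w \<in> I")
        case False
        then show ?thesis using keys_span[OF s] by (simp add: lookup_eq_0_of_keys_subset)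
      next
        case True
        then have "T w \<in> cvs.span (T ` B)" using B0(3) B(3) by auto
        then obtain r where r: "T w = (\<Sum>b\<in>B. cscale (r b) (T b))"
          using cvs.span_finite[of "T ` B"] finB B(2) by (auto simp: sum.reindex)
        \<comment> \<open>The coefficients of the relation
          \<open>T w - (\<Sum>b\<in>B. cscale (r b) (T b)) = 0\<close>; as a difference of two
          indicator terms they also cover \<open>w \<in> B\<close>.\<close>
        define c where "c x = (if x = w then 1 else 0) - (if x \<in> B then r x else 0)" for x
        have "(\<Sum>x\<in>I. cscale (c x) (T x)) =
            (\<Sum>x\<in>I. if x = w then T x else 0) - (\<Sum>x\<in>I. if x \<in> B then cscale (r x) (T x) else 0)"
          by (auto simp: c_def cvs.scale_left_diff_distrib simp flip: sum_subtractf intro!: sum.cong)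
        also have "\<dots> = T w - (\<Sum>b\<in>B. cscale (r b) (T b))"
          using True I B(1) by (simp add: sum.delta' Int_absorb1 flip: sum.inter_restrict)
        finally have "(\<Sum>x\<in>I. c x * lookup s x) = 0"
          using rel_span[OF s] r by simp
        \<comment> \<open>Since \<open>s\<close> vanishes on \<open>B\<close>, the only term that
          can survive is the one at \<open>w\<close>.\<close>
        moreover have "(\<Sum>x\<in>I. c x * lookup s x) = (\<Sum>x\<in>I. if x = w then lookup s x else 0)"
          by (intro sum.cong) (auto simp: c_def sB)
        ultimately show ?thesis using True I by simp
      qed
    qed
    then show ?thesis
      by (simp add: \<pi>_def inj_on_component_iff)
  qed
  have "e b \<in> cvs.span (\<pi> ` S)" if b: "b \<in> B" for b
  proof (rule ccontr)
    assume "e b \<notin> cvs.span (\<pi> ` S)"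
    then obtain \<phi> where \<phi>:
      "\<And>J s. finite J \<Longrightarrow> keys s \<subseteq> J \<Longrightarrow> s \<in> cvs.span (\<pi> ` S) \<Longrightarrow> (\<Sum>a\<in>J. \<phi> a * lookup s a) = 0"
      "\<And>J. finite J \<Longrightarrow> keys (e b) \<subseteq> J \<Longrightarrow> (\<Sum>a\<in>J. \<phi> a * lookup (e b) a) = 1"
      by (rule separating_functional) blast
    define c where "c x = (if x \<in> B then \<phi> x else 0)" for x
    have "(\<Sum>w\<in>I. c w * lookup s w) = 0" if "s \<in> S" for s
    proof -
      have "keys (\<pi> s) \<subseteq> B"
        by (auto simp: \<pi>_def in_keys_iff lookup_component split: if_splits)
      then have "0 = (\<Sum>a\<in>B. \<phi> a * lookup (\<pi> s) a)"
        using \<phi>(1)[OF finB] that by (simp add: cvs.span_base)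
      also have "\<dots> = (\<Sum>w\<in>I. c w * lookup s w)"
        by (rule sum.mono_neutral_cong_left) (use I B(1) in \<open>auto simp: c_def \<pi>_def lookup_component\<close>)
      finally show ?thesis by simp
    qed
    then have "0 = (\<Sum>w\<in>I. cscale (c w) (T w))" using rel by simp
    also have "\<dots> = (\<Sum>w\<in>B. cscale (\<phi> w) (T w))"
      by (rule sum.mono_neutral_cong_right) (use I B(1) in \<open>auto simp: c_def\<close>)
    also have "\<dots> = (\<Sum>t\<in>T ` B. cscale (\<phi> (the_inv_into B T t)) t)"
      using B(2) by (simp add: sum.reindex the_inv_into_f_f)
    finally have "\<phi> (the_inv_into B T (T b)) = 0"
      using cvs.independentD[OF B0(2), of "T ` B" "\<lambda>t. \<phi> (the_inv_into B T t)" "T b"] B(3) b finB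
      by simp
    then have "\<phi> b = 0" using B(2) b by (simp add: the_inv_into_f_f)
    then show False using \<phi>(2)[of "{b}"] by (simp add: e_def)
  qed
  then have "cvs.span (e ` B) \<subseteq> cvs.span (\<pi> ` S)"
    by (intro cvs.span_minimal) auto
  moreover have "\<pi> s \<in> cvs.span (e ` B)" for s
  proof -
    have "\<pi> s = (\<Sum>a\<in>B. cscale (lookup (\<pi> s) a) (e a))"
      unfolding e_def
      by (rule poly_mapping_as_cscale_sum[OF finB])
        (auto simp: \<pi>_def in_keys_iff lookup_component split: if_splits)
    also have "\<dots> \<in> cvs.span (e ` B)"
      by (intro cvs.span_sum cvs.span_scale cvs.span_base) auto
    finally show ?thesis .
  qed
  then have "cvs.span (\<pi> ` S) \<subseteq> cvs.span (e ` B)"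
    by (intro cvs.span_minimal) auto
  ultimately have span_\<pi>: "cvs.span (\<pi> ` S) = cvs.span (e ` B)" by blast
  have inj_e: "inj_on e B"
    by (auto simp: inj_on_def e_def poly_mapping_eq_iff lookup_single fun_eq_iff when_def split: if_splits)
  have ind_e: "cvs.independent (e ` B)"
  proof (rule cvs.independent_if_scalars_zero)
    fix f x
    assume 0: "(\<Sum>x\<in>e ` B. cscale (f x) x) = 0" and "x \<in> e ` B"
    then obtain b where b: "b \<in> B" "x = e b" by blast
    have "0 = lookup (\<Sum>x\<in>B. cscale (f (e x)) (e x)) b"
      using 0 inj_e by (simp add: sum.reindex)
    also have "\<dots> = (\<Sum>x\<in>B. if x = b then f (e x) else 0)"
      by (auto simp: lookup_sum e_def lookup_single when_def intro!: sum.cong)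
    also have "\<dots> = f x" using b finB by simp
    finally show "f x = 0" by simp
  qed (use finB in auto)
  obtain C where C: "C \<subseteq> cvs.span S" "cvs.independent C" "cvs.span S \<subseteq> cvs.span C"
      "card C = cvs.dim (cvs.span S)"
    by (rule cvs.basis_exists)
  have span_C: "cvs.span C = cvs.span S"
    using C(1,3) cvs.span_minimal[OF C(1)] by auto
  \<comment> \<open>By injectivity, \<open>\<pi>\<close> carries the basis \<open>C\<close> of
    \<open>cvs.span S\<close> to a basis of its image.\<close>
  have "cvs.dim (cvs.span (\<pi> ` S)) = card (\<pi> ` C)"
  proof (rule cvs.dim_eq_card)
    show "cvs.span (\<pi> ` C) = cvs.span (cvs.span (\<pi> ` S))"
      by (simp add: \<pi>_def span_image_component span_C cvs.span_span)
    show "cvs.independent (\<pi> ` C)"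
      using C(2) inj span_C unfolding \<pi>_def by (intro independent_image_component) auto
  qed
  also have "\<dots> = card C"
    by (rule card_image) (rule inj_on_subset[OF inj C(1)])
  finally have "cvs.dim (cvs.span S) = cvs.dim (cvs.span (e ` B))"
    using C(4) span_\<pi> by simp
  also have "\<dots> = card B"
    using ind_e inj_e by (simp add: cvs.dim_eq_card_independent card_image)
  finally show ?thesis using dimT by simp
qed

section \<open>Spans of homogeneous elements\<close>

text \<open>Taking the part of degree \<open>g\<close> is linear, fixes \<open>p\<close>, and sends
  each generator \<open>T w\<close> to itself or to 0 according to whether
  \<open>\<delta> w = g\<close>. Hence it rewrites \<open>p\<close> as a combination of generators
  of degree \<open>g\<close>.\<close>

lemma homogeneous_part_span:
  assumes hom: "\<And>w u. w \<in> W \<Longrightarrow> u \<in> keys (T w) \<Longrightarrow> \<gamma> u = \<delta> w"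
  shows "{p \<in> cvs.span (T ` W). \<forall>u\<in>keys p. \<gamma> u = g} = cvs.span (T ` {w\<in>W. \<delta> w = g})"
    (is "?L = cvs.span ?R")
proof
  show "?L \<subseteq> cvs.span ?R"
  proof
    fix p assume p: "p \<in> ?L"
    have "p = component (\<lambda>u. \<gamma> u = g) p"
      using p by (intro component_eq_self[symmetric]) auto
    also have "\<dots> \<in> cvs.span (component (\<lambda>u. \<gamma> u = g) ` T ` W)"
      using p by (auto simp: span_image_component)
    also have "\<dots> \<subseteq> cvs.span ?R"
    proof (intro cvs.span_minimal subsetI)
      fix q assume "q \<in> component (\<lambda>u. \<gamma> u = g) ` T ` W"
      then obtain w where w: "w \<in> W" "q = component (\<lambda>u. \<gamma> u = g) (T w)" by blast
      show "q \<in> cvs.span ?R"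
      proof (cases "\<delta> w = g")
        case True
        then have "q = T w" using w hom by (auto intro!: component_eq_self)
        then show ?thesis using w True by (auto intro: cvs.span_base)
      next
        case False
        then have "q = 0" using w hom by (auto intro!: component_eq_0)
        then show ?thesis by (simp add: cvs.span_zero)
      qed
    qed simp
    finally show "p \<in> cvs.span ?R" .
  qed
  show "cvs.span ?R \<subseteq> ?L"
  proof
    fix p assume p: "p \<in> cvs.span ?R"
    then have "p \<in> cvs.span (T ` W)"
      using cvs.span_mono[of ?R "T ` W"] by auto
    moreover have "\<forall>u\<in>keys p. \<gamma> u = g"
      using p
    proof (induction rule: cvs.span_induct_alt)
      case (step a x y)
      then have "\<forall>u\<in>keys x. \<gamma> u = g" using hom by auto
      with step show ?case by (force simp: in_keys_iff lookup_add)
    qed simp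
    ultimately show "p \<in> ?L" by simp
  qed
qed

text \<open>The span is the direct sum of its homogeneous pieces: bases of the pieces are disjoint
  and unite to a basis of the whole.\<close>

lemma dim_span_graded:
  assumes W: "finite W" and G: "finite G" "\<delta> ` W \<subseteq> G"
    and hom: "\<And>w u. w \<in> W \<Longrightarrow> u \<in> keys (T w) \<Longrightarrow> \<gamma> u = \<delta> w"
  shows "cvs.dim (cvs.span (T ` W)) = (\<Sum>g\<in>G. cvs.dim (cvs.span (T ` {w\<in>W. \<delta> w = g})))"
proof -
  let ?V = "\<lambda>g. cvs.span (T ` {w\<in>W. \<delta> w = g})"
  define basis_of where "basis_of g B \<longleftrightarrow> B \<subseteq> ?V g \<and> cvs.independent B \<and> ?V g \<subseteq> cvs.span B \<and>
    card B = cvs.dim (?V g)" for g B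
  have "\<exists>B. basis_of g B" for g
    unfolding basis_of_def by (meson cvs.basis_exists)
  then obtain B where "\<And>g. basis_of g (B g)" by metis
  then have B: "\<And>g. B g \<subseteq> ?V g" "\<And>g. cvs.independent (B g)"
    "\<And>g. ?V g \<subseteq> cvs.span (B g)" "\<And>g. card (B g) = cvs.dim (?V g)"
    unfolding basis_of_def by blast+
  have finB: "finite (B g)" for g
    using cvs.independent_span_bound[OF _ B(2) B(1), of g] W by simp
  have \<gamma>B: "\<gamma> u = g" if "b \<in> B g" "u \<in> keys b" for b g u
    using that B(1)[of g] homogeneous_part_span[of W T \<gamma> \<delta> g, OF hom] by blast
  \<comment> \<open>A common element would have no monomials, since each would have both degrees;
    but 0 lies in no independent set.\<close>
  have disj: "B g \<inter> B g' = {}" if "g \<noteq> g'" for g g'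
  proof (rule ccontr)
    assume "B g \<inter> B g' \<noteq> {}"
    then obtain b where b: "b \<in> B g" "b \<in> B g'" by blast
    then have "keys b = {}" using \<gamma>B that by blast
    then have "0 \<in> B g" using b by simp
    then show False using B(2) cvs.dependent_zero by blast
  qed
  have "cvs.dim (cvs.span (T ` W)) = card (\<Union>g\<in>G. B g)"
  proof (rule cvs.dim_unique)
    show "(\<Union>g\<in>G. B g) \<subseteq> cvs.span (T ` W)"
      using B(1) cvs.span_mono[of "T ` {w\<in>W. \<delta> w = _}" "T ` W"] by blast
    show "cvs.span (T ` W) \<subseteq> cvs.span (\<Union>g\<in>G. B g)"
    proof (intro cvs.span_minimal subsetI)
      fix p assume "p \<in> T ` W"
      then obtain w where w: "w \<in> W" "p = T w" by blast
      then have "p \<in> ?V (\<delta> w)" by (auto intro: cvs.span_base)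
      then have "p \<in> cvs.span (B (\<delta> w))" using B(3) by blast
      also have "\<dots> \<subseteq> cvs.span (\<Union>g\<in>G. B g)"
        using G(2) w by (intro cvs.span_mono) auto
      finally show "p \<in> cvs.span (\<Union>g\<in>G. B g)" .
    qed simp
    show "cvs.independent (\<Union>g\<in>G. B g)"
    proof (rule cvs.independent_if_scalars_zero)
      fix f x
      assume 0: "(\<Sum>b\<in>(\<Union>g\<in>G. B g). cscale (f b) b) = 0" and "x \<in> (\<Union>g\<in>G. B g)"
      then obtain g where g: "g \<in> G" "x \<in> B g" by blast
      \<comment> \<open>Projecting a relation to degree \<open>g\<close> keeps only the terms from
        \<open>B g\<close>, where independence is known.\<close>
      have "component (\<lambda>u. \<gamma> u = g) b = (if b \<in> B g then b else 0)"
        if "b \<in> (\<Union>g\<in>G. B g)" for b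
        using that \<gamma>B disj by (auto intro!: component_eq_self component_eq_0)
      then have "component (\<lambda>u. \<gamma> u = g) (\<Sum>b\<in>(\<Union>g\<in>G. B g). cscale (f b) b) =
          (\<Sum>b\<in>(\<Union>g\<in>G. B g). cscale (f b) (if b \<in> B g then b else 0))"
        by (simp add: component_sum component_cscale)
      also have "\<dots> = (\<Sum>b\<in>B g. cscale (f b) b)"
        by (rule sum.mono_neutral_cong_right) (use G finB g in auto)
      finally have "(\<Sum>b\<in>B g. cscale (f b) b) = 0" by (simp add: 0 component_0)
      then show "f x = 0" using cvs.independentD[OF B(2) finB] g by blast
    qed (use G finB in auto)
  qed simp
  also have "\<dots> = (\<Sum>g\<in>G. card (B g))"
    using G finB disj by (intro card_UN_disjoint) auto
  finally show ?thesis by (simp add: B(4))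
qed


section \<open>Evaluation of polynomials\<close>

text \<open>Dedekind's argument: distinct monomials are distinct characters of the multiplicative monoid of
  points, hence linearly independent as functions.\<close>

lemma monomial_sum_eq_0:
  assumes "finite U" "\<And>a :: 'v \<Rightarrow> complex. (\<Sum>u\<in>U. c u * (\<Prod>v\<in>keys u. a v ^ lookup u v)) = 0"
    and "u \<in> U"
  shows "c u = (0 :: complex)"
  using assms
proof (induction U arbitrary: c u rule: finite_induct)
  case (insert u0 U)
  define ev where "ev u a = (\<Prod>v\<in>keys u. a v ^ lookup u v)" for u and a :: "'v \<Rightarrow> complex"
  have ev_mult: "ev u (\<lambda>v. a v * b v) = ev u a * ev u b" for u a b
    by (simp add: ev_def power_mult_distrib prod.distrib)
  have zero: "(\<Sum>u\<in>insert u0 U. c u * ev u a) = 0" for a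
    using insert.prems(1) by (simp add: ev_def)
  have cU: "c u = 0" if u: "u \<in> U" for u
  proof -
    have "u \<noteq> u0" using u insert.hyps by blast
    then obtain v where v: "lookup u v \<noteq> lookup u0 v"
      by (meson poly_mapping_eqI)
    \<comment> \<open>At this point a monomial takes the value 2 to the power of its exponent at
      \<open>v\<close>, so it separates \<open>u\<close> from \<open>u0\<close>.\<close>
    define b :: "'v \<Rightarrow> complex" where "b x = (if x = v then 2 else 1)" for x
    have evb: "ev w b = 2 ^ lookup w v" for w
    proof -
      have "ev w b = (\<Prod>x\<in>keys w. if x = v then 2 ^ lookup w v else 1)"
        unfolding ev_def b_def by (rule prod.cong) auto
      then show ?thesis by (simp add: prod.delta' in_keys_iff)
    qed
    have ne: "ev u b \<noteq> ev u0 b"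
    proof
      assume "ev u b = ev u0 b"
      then have "(of_nat (2 ^ lookup u v) :: complex) = of_nat (2 ^ lookup u0 v)"
        by (simp add: evb)
      then have "(2::nat) ^ lookup u v = 2 ^ lookup u0 v" using of_nat_eq_iff by blast
      then show False using v by simp
    qed
    \<comment> \<open>The relation at the product point \<open>a * b\<close> minus
      \<open>ev u0 b\<close> times the relation at \<open>a\<close> loses its \<open>u0\<close>
      term, so the induction hypothesis applies on \<open>U\<close>.\<close>
    have "c u * (ev u b - ev u0 b) = 0"
    proof (rule insert.IH[where c = "\<lambda>w. c w * (ev w b - ev u0 b)"])
      fix a :: "'v \<Rightarrow> complex"
      have "(\<Sum>w\<in>U. c w * (ev w b - ev u0 b) * ev w a) =
          (\<Sum>w\<in>insert u0 U. c w * (ev w b - ev u0 b) * ev w a)"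
        using insert.hyps by simp
      also have "\<dots> = (\<Sum>w\<in>insert u0 U. c w * ev w (\<lambda>x. a x * b x)) -
          ev u0 b * (\<Sum>w\<in>insert u0 U. c w * ev w a)"
        unfolding ev_mult sum_distrib_left sum_subtractf[symmetric]
        by (rule sum.cong) (simp_all add: algebra_simps)
      also have "\<dots> = 0" unfolding zero by simp
      finally show "(\<Sum>w\<in>U. c w * (ev w b - ev u0 b) * (\<Prod>v\<in>keys w. a v ^ lookup w v)) = 0"
        by (simp add: ev_def)
    qed (rule u)
    then show ?thesis using ne by simp
  qed
  \<comment> \<open>Only the \<open>u0\<close> term remains, and every monomial equals 1 at the
    all-ones point.\<close>
  have "c u0 * ev u0 (\<lambda>_. 1) = 0"
    using zero[of "\<lambda>_. 1"] insert.hyps cU by simp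
  then have "c u0 = 0" by (simp add: ev_def)
  then show ?case using cU insert.prems by auto
qed simp

lemma poly_eval_id_eq_0_iff:
  fixes p :: "'v cpoly"
  shows "(\<forall>a. poly_eval id a p = 0) \<longleftrightarrow> p = 0"
proof
  assume "\<forall>a. poly_eval id a p = 0"
  then have "lookup p u = 0" if "u \<in> keys p" for u
    using that by (intro monomial_sum_eq_0[of "keys p" "lookup p"]) (auto simp: poly_eval_def)
  then show "p = 0" by (intro poly_mapping_eqI) (auto simp: in_keys_iff)
qed (simp add: poly_eval_def)

lemma poly_eval_cscale: "poly_eval id a (cscale c p) = c * poly_eval id a p"
  by (simp add: cscale_conv_mult poly_eval_mult)

section \<open>Zariski closure and linear span\<close>

text \<open>Needed because \<open>zariski_closure\<close> admits only polynomials in the variables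
  from \<open>I\<close> as test equations.\<close>

lemma keys_linear_form:
  assumes "finite I" "u \<in> keys (\<Sum>w\<in>I. cscale (\<phi> w) (Var w))"
  shows "keys u \<subseteq> I"
proof -
  have "(\<Sum>w\<in>I. \<phi> w * lookup (Var w) u) \<noteq> 0"
    using assms(2) by (simp add: in_keys_iff lookup_sum)
  then obtain w where "w \<in> I" "\<phi> w * lookup (Var w) u \<noteq> 0"
    by (rule sum.not_neutral_contains_not_neutral)
  then have "\<exists>w\<in>I. lookup (Var w) u \<noteq> 0" by auto
  then show ?thesis
    by (auto simp: Var_def lookup_single when_def split: if_splits)
qed

lemma zariski_closure_subset_span:
  assumes I: "finite I" and S: "\<And>s. s \<in> S \<Longrightarrow> keys s \<subseteq> I"
  shows "zariski_closure I S \<subseteq> cvs.span S"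
proof (rule subsetI, rule ccontr)
  fix t assume t: "t \<in> zariski_closure I S" "t \<notin> cvs.span S"
  obtain \<phi> where \<phi>:
    "\<And>J s. finite J \<Longrightarrow> keys s \<subseteq> J \<Longrightarrow> s \<in> cvs.span S \<Longrightarrow> (\<Sum>a\<in>J. \<phi> a * lookup s a) = 0"
    "\<And>J. finite J \<Longrightarrow> keys t \<subseteq> J \<Longrightarrow> (\<Sum>a\<in>J. \<phi> a * lookup t a) = 1"
    using separating_functional[OF t(2)] by blast
  \<comment> \<open>The separating functional, written as a linear form in the coordinates: it
    vanishes on \<open>S\<close> but equals 1 at \<open>t\<close>.\<close>
  let ?p = "\<Sum>w\<in>I. cscale (\<phi> w) (Var w)"
  have ev: "poly_eval id (lookup s) ?p = (\<Sum>w\<in>I. \<phi> w * lookup s w)" for s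
    by (simp add: poly_eval_sum poly_eval_cscale)
  have "\<forall>u\<in>keys ?p. keys u \<subseteq> I"
    using keys_linear_form[OF I] by blast
  moreover have "\<forall>s\<in>S. poly_eval id (lookup s) ?p = 0"
    unfolding ev using \<phi>(1) I S by (auto intro: cvs.span_base)
  ultimately have "poly_eval id (lookup t) ?p = 0"
    using t(1) unfolding zariski_closure_def by blast
  moreover have "keys t \<subseteq> I" using t(1) by (simp add: zariski_closure_def)
  ultimately show False using \<phi>(2)[OF I] ev by simp
qed

lemma span_zariski_closure:
  assumes "finite I" "\<And>s. s \<in> S \<Longrightarrow> keys s \<subseteq> I"
  shows "cvs.span (zariski_closure I S) = cvs.span S"
proof -
  have "S \<subseteq> zariski_closure I S" using assms(2) by (auto simp: zariski_closure_def)
  then have "cvs.span S \<subseteq> cvs.span (zariski_closure I S)" by (rule cvs.span_mono)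
  moreover have "cvs.span (zariski_closure I S) \<subseteq> cvs.span S"
    using zariski_closure_subset_span[OF assms] by (intro cvs.span_minimal) auto
  ultimately show ?thesis by blast
qed


section \<open>Traces of words in the generic matrices\<close>

definition trace_word :: "'n list \<Rightarrow> ('m::finite, 'n) mat_poly" where
  "trace_word w = trace (word_prod generic_mat w)"

lemma finite_words: "finite (words d :: 'n::finite list set)"
  using finite_lists_length_eq[of "UNIV :: 'n set" d] by (simp add: words_def)

text \<open>Evaluation at the entries of \<open>A\<close> is a ring homomorphism taking the generic
  matrices to the \<open>A k\<close>, so entrywise it commutes with matrix products and
  traces.\<close>

lemma trace_word_prod_conv_poly_eval:
  fixes A :: "'n \<Rightarrow> complex ^ 'm ^ 'm::finite"
  shows "trace (word_prod A w) = poly_eval id (\<lambda>(k, i, j). A k $ i $ j) (trace_word w)"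
proof -
  define E where "E = (poly_eval id (\<lambda>(k, i, j). A k $ i $ j) :: ('m, 'n) mat_poly \<Rightarrow> complex)"
  have E: "E 0 = 0" "E 1 = 1" "\<And>p q. E (p * q) = E p * E q"
    using poly_eval_Const[of id "\<lambda>(k, i, j). A k $ i $ j" 1]
    by (simp_all add: E_def poly_eval_mult) (simp add: poly_eval_def)
  have Es: "E (\<Sum>i\<in>J. q i) = (\<Sum>i\<in>J. E (q i))" for q and J :: "'m set"
    unfolding E_def by (rule poly_eval_sum) auto
  have "word_prod A w $ i $ j = E (word_prod generic_mat w $ i $ j)" for i j
  proof (induction w arbitrary: i j)
    case Nil
    then show ?case by (simp add: word_prod_def mat_def E)
  next
    case (Cons k w)
    have "word_prod A (k # w) $ i $ j = (\<Sum>l\<in>UNIV. A k $ i $ l * word_prod A w $ l $ j)"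
      by (simp add: word_prod_def matrix_matrix_mult_def)
    also have "\<dots> = E (\<Sum>l\<in>UNIV. generic_mat k $ i $ l * word_prod generic_mat w $ l $ j)"
      by (simp add: Cons Es E(3) generic_mat_def[of k], simp add: E_def)
    finally show ?case by (simp add: word_prod_def matrix_matrix_mult_def)
  qed
  then show ?thesis by (simp add: trace_def trace_word_def Es flip: E_def)
qed

lemma lookup_mps_map:
  fixes A :: "'n::finite \<Rightarrow> complex ^ 'm ^ 'm::finite"
  shows "lookup (mps_map d A) w = (if w \<in> words d then trace (word_prod A w) else 0)"
  by (auto simp: mps_map_def lookup_sum lookup_single when_def finite_words if_distrib cong: if_cong)

lemma trace_nc_eval:
  "trace (nc_eval f generic_mat) = (\<Sum>w\<in>keys f. cscale (lookup f w) (trace_word w))"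
  by (simp add: nc_eval_def trace_word_def cscale_conv_mult trace_def matrix_matrix_mult_def mat_def
      if_distrib[of "\<lambda>x. x * _"] sum_distrib_left sum.swap[of _ "keys f"] cong: if_cong)

text \<open>The trace of a noncommutative polynomial is linear in the polynomial, and the words are
  a basis of these polynomials.\<close>

lemma R_cyc_eq_span_trace_word:
  "R_cyc TYPE('m::finite) TYPE('n::finite) = cvs.span (range trace_word)"
proof -
  let ?t = "\<lambda>f. trace (nc_eval f generic_mat) :: ('m, 'n) mat_poly"
  have "range ?t \<subseteq> cvs.span (range trace_word)"
    by (simp add: image_subset_iff trace_nc_eval cvs.span_sum cvs.span_scale cvs.span_base)
  moreover have "trace_word w = ?t (Poly_Mapping.single w 1)" for w
    by (simp add: trace_nc_eval)
  then have "range trace_word \<subseteq> range ?t" by blast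
  then have "cvs.span (range trace_word) \<subseteq> cvs.span (range ?t)" by (rule cvs.span_mono)
  ultimately show ?thesis
    unfolding R_cyc_def using cvs.span_minimal[of "range ?t"] by blast
qed

section \<open>Multidegrees of traces of words\<close>

text \<open>A summation range independent of \<open>u\<close> makes additivity a termwise
  matter.\<close>

lemma multidegree_conv_UNIV:
  fixes u :: "'n::finite \<times> 'm::finite \<times> 'm \<Rightarrow>\<^sub>0 nat"
  shows "multidegree u k = (\<Sum>v | fst v = k. lookup u v)"
  unfolding multidegree_def by (rule sum.mono_neutral_left) (auto simp: in_keys_iff)

lemma multidegree_add:
  fixes u :: "'n::finite \<times> 'm::finite \<times> 'm \<Rightarrow>\<^sub>0 nat"
  shows "multidegree (u + v) k = multidegree u k + multidegree v k"
  by (simp add: multidegree_conv_UNIV lookup_add sum.distrib)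

lemma sum_multidegree:
  fixes u :: "'n::finite \<times> 'm::finite \<times> 'm \<Rightarrow>\<^sub>0 nat"
  shows "(\<Sum>k\<in>UNIV. multidegree u k) = (\<Sum>v\<in>keys u. lookup u v)"
proof -
  have "(\<Sum>k\<in>UNIV. multidegree u k) = (\<Sum>v\<in>UNIV. lookup u v)"
    using sum.group[of "UNIV :: ('n \<times> 'm \<times> 'm) set" UNIV fst "lookup u"]
    by (simp add: multidegree_conv_UNIV)
  also have "\<dots> = (\<Sum>v\<in>keys u. lookup u v)"
    by (rule sum.mono_neutral_right) (auto simp: in_keys_iff)
  finally show ?thesis .
qed

text \<open>Every monomial of an entry takes one variable from each factor, and the factor of letter
  \<open>k\<close> contributes degree one in \<open>k\<close>. The row index is generalized because
  expanding the first factor changes it.\<close>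

lemma multidegree_word_prod:
  fixes u :: "'n::finite \<times> 'm::finite \<times> 'm \<Rightarrow>\<^sub>0 nat"
  assumes "u \<in> keys (word_prod generic_mat w $ i $ j)"
  shows "multidegree u = count_list w"
  using assms
proof (induction w arbitrary: u i)
  case Nil
  then have "u = 0" by (auto simp: word_prod_def mat_def split: if_splits)
  then show ?case by (auto simp: multidegree_def)
next
  case (Cons k w)
  have "u \<in> keys (\<Sum>l\<in>UNIV. Var (k, i, l) * word_prod generic_mat w $ l $ j)"
    using Cons.prems by (simp add: word_prod_def matrix_matrix_mult_def generic_mat_def[of k])
  then obtain l where "u \<in> keys (Var (k, i, l) * word_prod generic_mat w $ l $ j)"
    using keys_sum[of "\<lambda>l. Var (k, i, l) * word_prod generic_mat w $ l $ j" UNIV] by blast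
  then obtain u1 u2 where u: "u = u1 + u2" "u1 \<in> keys (Var (k, i, l) :: ('m, 'n) mat_poly)"
      "u2 \<in> keys (word_prod generic_mat w $ l $ j)"
    using keys_mult[of "Var (k, i, l)" "word_prod generic_mat w $ l $ j"] by blast
  have u1: "u1 = Poly_Mapping.single (k, i, l) 1"
    using u(2) by (simp add: Var_def)
  have "multidegree u1 k' = (if k = k' then 1 else 0)" for k'
    unfolding u1 multidegree_conv_UNIV
    by (auto simp: lookup_single when_def if_distrib sum.delta' cong: if_cong)
  then show ?case
    using Cons.IH[OF u(3)] by (auto simp: u(1) multidegree_add fun_eq_iff)
qed

lemma multidegree_trace_word:
  fixes u :: "'n::finite \<times> 'm::finite \<times> 'm \<Rightarrow>\<^sub>0 nat"
  assumes "u \<in> keys (trace_word w)"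
  shows "multidegree u = count_list w"
proof -
  obtain i where "u \<in> keys (word_prod generic_mat w $ i $ i)"
    using assms keys_sum[of "\<lambda>i. word_prod generic_mat w $ i $ i" UNIV]
    unfolding trace_word_def trace_def by blast
  then show ?thesis by (rule multidegree_word_prod)
qed

lemma sum_count_list_UNIV: "(\<Sum>k\<in>UNIV. count_list w (k::'n::finite)) = length w"
  by (rule sum_count_set) auto

lemma degree_trace_word:
  fixes u :: "'n::finite \<times> 'm::finite \<times> 'm \<Rightarrow>\<^sub>0 nat"
  assumes "u \<in> keys (trace_word w)"
  shows "(\<Sum>v\<in>keys u. lookup u v) = length w"
  using multidegree_trace_word[OF assms]
  by (simp flip: sum_multidegree add: sum_count_list_UNIV)

lemma degree_part_R_cyc:
  "degree_part (R_cyc TYPE('m::finite) TYPE('n::finite)) d = cvs.span (trace_word ` words d)"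
  unfolding degree_part_def R_cyc_eq_span_trace_word words_def
  using homogeneous_part_span[of UNIV trace_word "\<lambda>u. \<Sum>v\<in>keys u. lookup u v" length d,
      OF degree_trace_word]
  by simp

lemma multidegree_part_R_cyc:
  "multidegree_part (R_cyc TYPE('m::finite) TYPE('n::finite)) \<delta> =
    cvs.span (trace_word ` {w. count_list w = \<delta>})"
  unfolding multidegree_part_def R_cyc_eq_span_trace_word
  using homogeneous_part_span[of UNIV trace_word multidegree count_list \<delta>,
      OF multidegree_trace_word]
  by simp

section \<open>Comparison of the dimensions\<close>

text \<open>Evaluating the left-hand combination at \<open>A\<close> gives the right-hand sum for
  the tensor of \<open>A\<close>, and a polynomial is zero exactly when all its values are. This is
  the relation hypothesis of \<open>dim_span_eq_of_same_relations\<close>.\<close>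

lemma trace_word_relation_iff:
  "(\<Sum>w\<in>words d. cscale (c w) (trace_word w :: ('m::finite, 'n::finite) mat_poly)) = 0 \<longleftrightarrow>
    (\<forall>s\<in>range (mps_map d :: ('n \<Rightarrow> complex ^ 'm ^ 'm) \<Rightarrow> _). (\<Sum>w\<in>words d. c w * lookup s w) = 0)"
proof -
  let ?p = "\<Sum>w\<in>words d. cscale (c w) (trace_word w :: ('m, 'n) mat_poly)"
  let ?pt = "\<lambda>(A :: 'n \<Rightarrow> complex ^ 'm ^ 'm) (k, i, j). A k $ i $ j"
  have ev: "(\<Sum>w\<in>words d. c w * lookup (mps_map d A) w) = poly_eval id (?pt A) ?p"
    for A :: "'n \<Rightarrow> complex ^ 'm ^ 'm"
    by (simp add: lookup_mps_map poly_eval_sum poly_eval_cscale trace_word_prod_conv_poly_eval)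
  \<comment> \<open>Every assignment of values to the variables comes from a tuple of matrices, so
    vanishing on tuples is vanishing at all points.\<close>
  have "surj ?pt"
  proof (rule surjI)
    show "?pt (\<lambda>k. \<chi> i j. a (k, i, j)) = a" for a
      by auto
  qed
  then have "(\<forall>A. poly_eval id (?pt A) ?p = 0) \<longleftrightarrow> (\<forall>a. poly_eval id a ?p = 0)"
    by (metis (no_types, lifting) surjD)
  then show ?thesis by (simp add: ev poly_eval_id_eq_0_iff)
qed

lemma dim_span_uMPS:
  "cvs.dim (cvs.span (uMPS TYPE('m::finite) TYPE('n::finite) d)) =
    cvs.dim (degree_part (R_cyc TYPE('m) TYPE('n)) d)"
proof -
  let ?S = "range (mps_map d :: ('n \<Rightarrow> complex ^ 'm ^ 'm) \<Rightarrow> _)"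
  have keys: "keys s \<subseteq> words d" if "s \<in> ?S" for s
    using that by (auto simp: in_keys_iff lookup_mps_map split: if_splits)
  have "cvs.span (uMPS TYPE('m) TYPE('n) d) = cvs.span ?S"
    unfolding uMPS_def using keys by (intro span_zariski_closure finite_words)
  also have "cvs.dim \<dots> = cvs.dim (cvs.span (trace_word ` words d :: ('m, 'n) mat_poly set))"
    using finite_words keys trace_word_relation_iff by (rule dim_span_eq_of_same_relations)
  finally show ?thesis by (simp only: degree_part_R_cyc)
qed

text \<open>Each coordinate is at most the total, which leaves a finite box. Finiteness matters
  since a sum over an infinite set would be 0 by convention.\<close>

lemma finite_multidegrees: "finite {\<delta> :: 'n::finite \<Rightarrow> nat. (\<Sum>k\<in>UNIV. \<delta> k) = d}"
proof (rule finite_subset)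
  show "{\<delta> :: 'n \<Rightarrow> nat. (\<Sum>k\<in>UNIV. \<delta> k) = d} \<subseteq> Pi\<^sub>E UNIV (\<lambda>_. {..d})"
    by (auto simp: PiE_UNIV_domain intro: member_le_sum)
qed (simp add: finite_PiE)

lemma dim_degree_part_R_cyc:
  "cvs.dim (degree_part (R_cyc TYPE('m::finite) TYPE('n::finite)) d) =
    (\<Sum>\<delta> | (\<Sum>k\<in>UNIV. \<delta> k) = d. hilbert_series (R_cyc TYPE('m) TYPE('n)) \<delta>)"
proof -
  let ?G = "{\<delta> :: 'n \<Rightarrow> nat. (\<Sum>k\<in>UNIV. \<delta> k) = d}"
  have "cvs.dim (degree_part (R_cyc TYPE('m) TYPE('n)) d) =
      (\<Sum>\<delta>\<in>?G. cvs.dim (cvs.span (trace_word ` {w \<in> words d. count_list w = \<delta>}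
        :: ('m, 'n) mat_poly set)))"
    unfolding degree_part_R_cyc
    using finite_words finite_multidegrees _ multidegree_trace_word
    by (rule dim_span_graded) (auto simp: sum_count_list_UNIV words_def)
  also have "\<dots> = (\<Sum>\<delta>\<in>?G. hilbert_series (R_cyc TYPE('m) TYPE('n)) \<delta>)"
  proof (rule sum.cong)
    fix \<delta> assume "\<delta> \<in> ?G"
    \<comment> \<open>The letter counts add up to the length, so a count with total \<open>d\<close>
      already forces length \<open>d\<close>.\<close>
    then have "{w \<in> words d. count_list w = \<delta>} = {w. count_list w = \<delta>}"
      by (auto simp: words_def sum_count_list_UNIV)
    then show "cvs.dim (cvs.span (trace_word ` {w \<in> words d. count_list w = \<delta>}
        :: ('m, 'n) mat_poly set)) = hilbert_series (R_cyc TYPE('m) TYPE('n)) \<delta>"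
      by (simp only: hilbert_series_def multidegree_part_R_cyc)
  qed simp
  finally show ?thesis .
qed

theorem mainTheorem3:
  shows "(\<forall>d. cvs.dim (cvs.span (uMPS TYPE('m::finite) TYPE('n::finite) d)) =
              cvs.dim (degree_part (R_cyc TYPE('m) TYPE('n)) d)) \<and>
         Abs_fps (\<lambda>d. cvs.dim (cvs.span (uMPS TYPE('m) TYPE('n) d))) =
           diagonal_fps (hilbert_series (R_cyc TYPE('m) TYPE('n)))"
  by (simp only: dim_span_uMPS dim_degree_part_R_cyc diagonal_fps_def simp_thms)

end
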